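(* For any finite connected graph $G$, there exists a smooth travel groupoid on $G$.
   Context: Graphs have no multiple edges and no loops. A groupoid $(V,\ast)$ is a non-empty set $V$ with a binary operation $\ast:V\times V\to V$. A travel groupoid is a groupoid $(V,\ast)$ satisfying (t1) $(u\ast v)\ast u=u$ for all $u,v\in V$; (t2) for all $u,v\in V$, if $(u\ast v)\ast v=u$, then $u=v$. A travel groupoid $(V,\ast)$ is on a graph $G$ if $V(G)=V$ and $E(G)=\{\{u,v\} \mid u,v\in V \text{ and } u\neq u\ast v=v\}$. A travel groupoid $(V,\ast)$ is smooth if it satisfies (t4) for all $u,v,w\in V$, if $u\ast v=u\ast w$, then $u\ast(w\ast v)=u\ast v$. *)

theory Defs
  imports Main
begin

type_synonym 'a ugraph = "'a set \<times> 'a set set"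

abbreviation verts :: "'a ugraph \<Rightarrow> 'a set" where
  "verts G \<equiv> fst G"

abbreviation edges :: "'a ugraph \<Rightarrow> 'a set set" where
  "edges G \<equiv> snd G"

definition simple_graph :: "'a ugraph \<Rightarrow> bool" where
  "simple_graph G \<longleftrightarrow> (\<forall>e \<in> edges G. e \<subseteq> verts G \<and> card e = 2)"

definition finite_graph :: "'a ugraph \<Rightarrow> bool" where
  "finite_graph G \<longleftrightarrow> simple_graph G \<and> finite (verts G)"

(* The null graph does not count as connected: the carrier of a groupoid is non-empty,
   so there is no groupoid on the null graph at all. *)
definition connected_graph :: "'a ugraph \<Rightarrow> bool" where
  "connected_graph G \<longleftrightarrow> simple_graph G \<and> verts G \<noteq> {} \<and>
     (\<forall>u \<in> verts G. \<forall>v \<in> verts G. (u, v) \<in> {(x, y). {x, y} \<in> edges G}\<^sup>*)"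

(* A binary operation on V is an HOL function of the whole type that maps V \<times> V into V;
   its values elsewhere are irrelevant. *)
definition groupoid :: "'a set \<Rightarrow> ('a \<Rightarrow> 'a \<Rightarrow> 'a) \<Rightarrow> bool" where
  "groupoid V f \<longleftrightarrow> V \<noteq> {} \<and> (\<forall>u \<in> V. \<forall>v \<in> V. f u v \<in> V)"

definition travel_groupoid :: "'a set \<Rightarrow> ('a \<Rightarrow> 'a \<Rightarrow> 'a) \<Rightarrow> bool" where
  "travel_groupoid V f \<longleftrightarrow> groupoid V f \<and>
     (\<forall>u \<in> V. \<forall>v \<in> V. f (f u v) u = u) \<and>
     (\<forall>u \<in> V. \<forall>v \<in> V. f (f u v) v = u \<longrightarrow> u = v)"

definition on_graph :: "'a set \<Rightarrow> ('a \<Rightarrow> 'a \<Rightarrow> 'a) \<Rightarrow> 'a ugraph \<Rightarrow> bool" where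
  "on_graph V f G \<longleftrightarrow> verts G = V \<and>
     edges G = {{u, v} | u v. u \<in> V \<and> v \<in> V \<and> u \<noteq> f u v \<and> f u v = v}"

definition smooth :: "'a set \<Rightarrow> ('a \<Rightarrow> 'a \<Rightarrow> 'a) \<Rightarrow> bool" where
  "smooth V f \<longleftrightarrow>
     (\<forall>u \<in> V. \<forall>v \<in> V. \<forall>w \<in> V. f u v = f u w \<longrightarrow> f u (f w v) = f u v)"

end

theory Submission
  imports Defs
begin

text \<open>
  Fix a spanning tree of \<open>G\<close>, and let \<open>u \<star> v\<close>, for \<open>u \<noteq> v\<close>, be the last vertex on the tree path
  from \<open>u\<close> to \<open>v\<close> that is adjacent to \<open>u\<close> in \<open>G\<close>. (The second vertex of that path is
  adjacent to \<open>u\<close>, so there is one.) If \<open>u\<close> and \<open>v\<close> are adjacent, then \<open>u \<star> v = v\<close>, which gives (t1)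
  and the correct edge set. The path from \<open>x = u \<star> v\<close> to \<open>v\<close> is a proper final segment of the
  path from \<open>u\<close> to \<open>v\<close>, so \<open>x \<star> v\<close> cannot be \<open>u\<close>, which gives (t2). Finally, root the tree
  at \<open>u\<close>: the set of \<open>v\<close> with \<open>u \<star> v = x\<close> is the subtree below \<open>x\<close> with the subtrees below all
  other neighbours of \<open>u\<close> removed. It is convex in the tree, hence contains \<open>w \<star> v\<close> along
  with \<open>w\<close> and \<open>v\<close>, and this is smoothness.

  The only properties of the tree used here concern the relation ``\<open>x\<close> lies on the tree path from \<open>a\<close>
  to \<open>b\<close>'', so the tree is represented by that ternary relation, through the axioms of the
  locale \<open>tree_betweenness\<close>. A relation satisfying them exists on every finite connected graph,
  because it extends to one more vertex attached as a leaf (\<open>tree_betweenness_add_leaf\<close>).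
\<close>

section \<open>Tree betweenness\<close>

text \<open>
  \<open>B a x b\<close> is read as: \<open>x\<close> lies on the tree path from \<open>a\<close> to \<open>b\<close>. The axiom \<open>tripod\<close>, which
  geodesics in a cycle of length at least four violate, holds because any walk in a tree from \<open>a\<close>
  to \<open>b\<close>, even a detour through \<open>c\<close>, covers the path from \<open>a\<close> to \<open>b\<close>. The axiom \<open>step\<close> ties the
  tree to the ambient graph: a tree path starts with an edge.
\<close>

locale tree_betweenness =
  fixes V :: "'a set" and adj :: "'a \<Rightarrow> 'a \<Rightarrow> bool" and B :: "'a \<Rightarrow> 'a \<Rightarrow> 'a \<Rightarrow> bool"
  assumes left_end: "\<lbrakk>a \<in> V; b \<in> V\<rbrakk> \<Longrightarrow> B a a b"
    and reverse: "\<lbrakk>a \<in> V; x \<in> V; b \<in> V; B a x b\<rbrakk> \<Longrightarrow> B b x a"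
    and loop_trivial: "\<lbrakk>a \<in> V; x \<in> V; B a x a\<rbrakk> \<Longrightarrow> x = a"
    and nested: "\<lbrakk>a \<in> V; x \<in> V; y \<in> V; b \<in> V; B a x b; B x y b\<rbrakk> \<Longrightarrow> B a y b \<and> B a x y"
    and tripod: "\<lbrakk>a \<in> V; x \<in> V; b \<in> V; c \<in> V; B a x b\<rbrakk> \<Longrightarrow> B a x c \<or> B c x b"
    and step: "\<lbrakk>a \<in> V; b \<in> V; a \<noteq> b\<rbrakk> \<Longrightarrow> \<exists>x\<in>V. adj a x \<and> B a x b"
begin

lemma right_end: "\<lbrakk>a \<in> V; b \<in> V\<rbrakk> \<Longrightarrow> B a b b"
  using left_end reverse by blast

lemma between_antisym: "\<lbrakk>a \<in> V; x \<in> V; b \<in> V; B a x b; B x a b\<rbrakk> \<Longrightarrow> x = a"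
  using nested loop_trivial by blast

lemma between_linear:
  assumes "a \<in> V" "x \<in> V" "y \<in> V" "b \<in> V" "B a x b" "B a y b"
  shows "B a x y \<or> B a y x"
  using tripod[of a x b y] nested[of a y x b] assms by blast

end

text \<open>
  A path that ends in the new leaf \<open>z\<close> is the path that ends in its parent \<open>p\<close>, followed by \<open>z\<close>;
  hence the substitution of \<open>p\<close> for \<open>z\<close> in the end points.
\<close>

lemma tree_betweenness_add_leaf:
  assumes "tree_betweenness S adj B" "p \<in> S" "z \<notin> S" "adj p z" "adj z p"
  shows "\<exists>B'. tree_betweenness (insert z S) adj B'"
proof -
  interpret tree_betweenness S adj B by fact
  define \<pi> where "\<pi> a = (if a = z then p else a)" for a
  define B' where "B' a x b \<longleftrightarrow>
    (if x = z then a = z \<or> b = z else \<not> (a = z \<and> b = z) \<and> B (\<pi> a) x (\<pi> b))" for a x b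
  have \<pi>: "\<pi> z = p" "a \<noteq> z \<Longrightarrow> \<pi> a = a" for a by (simp_all add: \<pi>_def)
  have \<pi>S: "\<pi> a \<in> S" if "a \<in> insert z S" for a using that assms(2) by (auto simp: \<pi>_def)
  have "tree_betweenness (insert z S) adj B'"
  proof
    fix a b assume "a \<in> insert z S" "b \<in> insert z S"
    then show "B' a a b" using left_end \<pi>S[of b] by (auto simp: B'_def \<pi>)
  next
    fix a x b assume "a \<in> insert z S" "x \<in> insert z S" "b \<in> insert z S" "B' a x b"
    then show "B' b x a" using reverse \<pi>S by (auto simp: B'_def split: if_splits)
  next
    fix a x assume "a \<in> insert z S" "x \<in> insert z S" "B' a x a"
    then show "x = a" using loop_trivial by (auto simp: B'_def \<pi> split: if_splits)
  next
    fix a x y b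
    assume V: "a \<in> insert z S" "x \<in> insert z S" "y \<in> insert z S" "b \<in> insert z S"
      and B: "B' a x b" "B' x y b"
    show "B' a y b \<and> B' a x y"
    proof (cases "x = z \<or> y = z")
      case True
      then show ?thesis using B by (auto simp: B'_def split: if_splits)
    next
      case False
      then have "B (\<pi> a) x (\<pi> b)" "B x y (\<pi> b)" using B by (auto simp: B'_def \<pi>)
      then have "B (\<pi> a) y (\<pi> b) \<and> B (\<pi> a) x y"
        using nested[of "\<pi> a" x y "\<pi> b"] V False \<pi>S by blast
      then show ?thesis using B False by (auto simp: B'_def \<pi>)
    qed
  next
    fix a x b c
    assume V: "a \<in> insert z S" "x \<in> insert z S" "b \<in> insert z S" "c \<in> insert z S"
      and B: "B' a x b"
    show "B' a x c \<or> B' c x b"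
    proof (cases "x = z \<or> c = z \<and> (a = z \<or> b = z)")
      case True
      then show ?thesis using B by (auto simp: B'_def split: if_splits)
    next
      case False
      then have "B (\<pi> a) x (\<pi> b)" using B by (simp add: B'_def)
      then have "B (\<pi> a) x (\<pi> c) \<or> B (\<pi> c) x (\<pi> b)"
        using tripod[of "\<pi> a" x "\<pi> b" "\<pi> c"] V False \<pi>S by blast
      then show ?thesis using False by (auto simp: B'_def)
    qed
  next
    fix a b assume V: "a \<in> insert z S" "b \<in> insert z S" "a \<noteq> b"
    show "\<exists>x\<in>insert z S. adj a x \<and> B' a x b"
    proof (cases "a = z")
      case True
      then have "adj a p" "B' a p b" using V assms left_end[of p b] by (auto simp: B'_def \<pi>)
      then show ?thesis using assms(2) by blast
    next
      case False
      show ?thesis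
      proof (cases "a = p \<and> b = z")
        case True
        then show ?thesis using assms by (auto simp: B'_def)
      next
        case nonleaf: False
        then have "a \<noteq> \<pi> b" using False V by (auto simp: \<pi>_def)
        then obtain x where "x \<in> S" "adj a x" "B a x (\<pi> b)"
          using step[of a "\<pi> b"] V False \<pi>S[of b] by auto
        then show ?thesis using False assms(3) by (auto simp: B'_def \<pi>)
      qed
    qed
  qed
  then show ?thesis by blast
qed

text \<open>
  A maximal subset carrying a tree betweenness is everything, since otherwise an edge leaves it and
  its outer end point can be attached as a leaf.
\<close>

lemma ex_tree_betweenness:
  assumes fin: "finite V" and ne: "V \<noteq> {}"
    and sym: "\<And>a b. adj a b \<Longrightarrow> adj b a" and inV: "\<And>a b. adj a b \<Longrightarrow> b \<in> V"
    and conn: "\<And>a b. \<lbrakk>a \<in> V; b \<in> V\<rbrakk> \<Longrightarrow> (a, b) \<in> {(x, y). adj x y}\<^sup>*"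
  shows "\<exists>B. tree_betweenness V adj B"
proof -
  define Q where "Q = {S. S \<subseteq> V \<and> S \<noteq> {} \<and> (\<exists>B. tree_betweenness S adj B)}"
  obtain v where "v \<in> V" using ne by blast
  moreover have "tree_betweenness {v} adj (\<lambda>_ _ _. True)"
    by standard auto
  ultimately have "{v} \<in> Q" unfolding Q_def by blast
  then have "Q \<noteq> {}" by blast
  moreover have "finite Q" using fin by (simp add: Q_def)
  ultimately obtain S where "S \<in> Q" and max: "\<forall>S'\<in>Q. S \<subseteq> S' \<longrightarrow> S = S'"
    using finite_has_maximal[of Q] by metis
  then have S: "S \<subseteq> V" "S \<noteq> {}" and "\<exists>B. tree_betweenness S adj B" by (auto simp: Q_def)
  then obtain B where B: "tree_betweenness S adj B" by blast
  have "S = V"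
  proof (rule ccontr)
    assume "S \<noteq> V"
    then obtain b a where ab: "b \<in> V" "b \<notin> S" "a \<in> S" using S by blast
    have "(a, b) \<in> {(x, y). adj x y}\<^sup>*" using conn ab S by blast
    then have "b \<notin> S \<longrightarrow> (\<exists>p z. p \<in> S \<and> z \<notin> S \<and> adj p z)"
      by (induction rule: rtrancl_induct) (use ab in auto)
    then obtain p z where pz: "p \<in> S" "z \<notin> S" "adj p z" using ab by blast
    have "\<exists>B. tree_betweenness (insert z S) adj B"
      using tree_betweenness_add_leaf[OF B pz sym[OF pz(3)]] .
    then have "insert z S \<in> Q" using inV[OF pz(3)] S by (simp add: Q_def)
    then show False using max pz(2) by blast
  qed
  then show ?thesis using B by blast
qed

section \<open>Walking to the last neighbour\<close>

text \<open>
  Along the path from \<open>u\<close> to \<open>v\<close>, later means farther from \<open>u\<close>: the neighbour \<open>x\<close> is last if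
  every neighbour \<open>n\<close> on the path lies between \<open>u\<close> and \<open>x\<close>.
\<close>

locale finite_tree_betweenness = tree_betweenness +
  assumes finite_V: "finite V"
    and adj_sym: "adj a b \<Longrightarrow> adj b a"
    and adj_irrefl: "\<not> adj a a"
begin

definition last_nbr :: "'a \<Rightarrow> 'a \<Rightarrow> 'a \<Rightarrow> bool" where
  "last_nbr u v x \<longleftrightarrow>
     x \<in> V \<and> adj u x \<and> B u x v \<and> (\<forall>n\<in>V. adj u n \<longrightarrow> B u n v \<longrightarrow> B u n x)"

definition walk :: "'a \<Rightarrow> 'a \<Rightarrow> 'a" where
  "walk u v = (if u = v then v else THE x. last_nbr u v x)"

lemma last_nbr_unique:
  assumes "u \<in> V" "last_nbr u v x" "last_nbr u v y"
  shows "x = y"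
  using assms between_antisym[of y x u] reverse unfolding last_nbr_def by blast

lemma ex_last_nbr:
  assumes u: "u \<in> V" and v: "v \<in> V" and "u \<noteq> v"
  shows "\<exists>x. last_nbr u v x"
proof -
  define N where "N = {n \<in> V. adj u n \<and> B u n v}"
  \<comment> \<open>Betweenness is linear on the path, so every finite nonempty set of its vertices has a
      farthest element.\<close>
  have "\<exists>x\<in>M. \<forall>n\<in>M. B u n x" if "finite M" "M \<noteq> {}" "M \<subseteq> N" for M
    using that
  proof (induction rule: finite_ne_induct)
    case (singleton m)
    then show ?case using right_end[OF u] by (auto simp: N_def)
  next
    case (insert m M)
    then obtain x where x: "x \<in> M" "\<forall>n\<in>M. B u n x" by auto
    have V: "m \<in> V" "x \<in> V" "M \<subseteq> V" and path: "B u m v" "B u x v"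
      using insert.prems x(1) by (auto simp: N_def)
    consider "B u m x" | "B u x m" using between_linear[OF u V(1,2) v path] by blast
    then show ?case
    proof cases
      case 1
      then show ?thesis using x by blast
    next
      case 2
      have "B u n m" if n: "n \<in> M" for n
      proof -
        have nV: "n \<in> V" using n V by blast
        have "B m x u" "B x n u" using reverse[OF u V(2,1) 2] reverse[OF u nV V(2)] x n by auto
        then show ?thesis using nested[of m x n u] reverse u V nV by blast
      qed
      then show ?thesis using right_end[OF u V(1)] by blast
    qed
  qed
  moreover have "finite N" "N \<noteq> {}" using finite_V step[OF assms] by (auto simp: N_def)
  ultimately obtain x where "x \<in> N" "\<forall>n\<in>N. B u n x" by blast
  then show ?thesis by (auto simp: last_nbr_def N_def)
qed

lemma walk_self [simp]: "walk u u = u"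
  by (simp add: walk_def)

lemma walk_eq_iff:
  assumes "u \<in> V" "v \<in> V" "u \<noteq> v"
  shows "walk u v = x \<longleftrightarrow> last_nbr u v x"
proof -
  have "\<exists>!x. last_nbr u v x" using ex_last_nbr[OF assms] last_nbr_unique[OF assms(1)] by blast
  from theI'[OF this] show ?thesis
    using last_nbr_unique[OF assms(1)] assms(3) by (auto simp: walk_def)
qed

lemma last_nbr_walk: "\<lbrakk>u \<in> V; v \<in> V; u \<noteq> v\<rbrakk> \<Longrightarrow> last_nbr u v (walk u v)"
  using walk_eq_iff by blast

lemma walk_neq:
  assumes "u \<in> V" "v \<in> V" "u \<noteq> v"
  shows "walk u v \<noteq> u"
  using last_nbr_walk[OF assms] adj_irrefl by (auto simp: last_nbr_def)

lemma walk_in: "\<lbrakk>u \<in> V; v \<in> V\<rbrakk> \<Longrightarrow> walk u v \<in> V"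
  by (cases "u = v") (use last_nbr_walk in \<open>auto simp: last_nbr_def\<close>)

lemma walk_between: "\<lbrakk>u \<in> V; v \<in> V\<rbrakk> \<Longrightarrow> B u (walk u v) v"
  by (cases "u = v") (use last_nbr_walk left_end in \<open>auto simp: last_nbr_def\<close>)

lemma walk_eq_target_iff:
  assumes "u \<in> V" "v \<in> V" "u \<noteq> v"
  shows "walk u v = v \<longleftrightarrow> adj u v"
  using assms right_end by (auto simp: walk_eq_iff last_nbr_def)

text \<open>
  One half of the convexity of the cells \<open>{v. walk u v = x}\<close>: such a cell is star-shaped around its
  own neighbour \<open>x\<close>, because moving \<open>v\<close> back towards \<open>x\<close> shortens the path from \<open>u\<close> without
  removing \<open>x\<close> from it.
\<close>

lemma last_nbr_star_shaped:
  assumes "u \<in> V" "v \<in> V" "y \<in> V" "last_nbr u v x" "B x y v"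
  shows "last_nbr u y x"
proof -
  have x: "x \<in> V" "B u x v" using assms(4) by (auto simp: last_nbr_def)
  have y: "B u y v" "B u x y" using nested[of u x y v] assms x by auto
  have "B u n v" if "n \<in> V" "B u n y" for n
    \<comment> \<open>nesting, read from the end \<open>v\<close> of the path\<close>
    using nested[of v y n u] reverse that y(1) assms(1-3) by blast
  then show ?thesis using assms(4) y(2) by (auto simp: last_nbr_def)
qed

text \<open>Star-shaped cells are convex: \<open>tripod\<close> moves a point between \<open>w\<close> and \<open>v\<close> onto a spoke.\<close>

lemma last_nbr_convex:
  assumes "u \<in> V" "v \<in> V" "w \<in> V" "y \<in> V" "last_nbr u v x" "last_nbr u w x" "B w y v"
  shows "last_nbr u y x"
proof -
  have "x \<in> V" using assms(5) by (simp add: last_nbr_def)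
  then have "B x y w \<or> B x y v" using tripod[of w y v x] reverse assms by blast
  then show ?thesis using last_nbr_star_shaped assms by blast
qed

theorem travel_groupoid_walk:
  assumes "V \<noteq> {}"
  shows "travel_groupoid V walk"
  unfolding travel_groupoid_def groupoid_def
proof (intro conjI ballI impI)
  fix u v assume V: "u \<in> V" "v \<in> V"
  show "walk (walk u v) u = u"
  proof (cases "u = v")
    case False
    then have "adj u (walk u v)" using last_nbr_walk V by (simp add: last_nbr_def)
    then show ?thesis
      using walk_eq_target_iff walk_in walk_neq adj_sym V False by blast
  qed simp
next
  fix u v assume V: "u \<in> V" "v \<in> V" and return: "walk (walk u v) v = u"
  have "B (walk u v) u v" using walk_between[of "walk u v" v] walk_in V return by simp
  then have "walk u v = u"
    using between_antisym[OF V(1) walk_in[OF V] V(2) walk_between[OF V]] by simp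
  then show "u = v" using walk_neq V by blast
qed (use assms walk_in in auto)

theorem smooth_walk: "smooth V walk"
  unfolding smooth_def
proof (intro ballI impI)
  fix u v w assume V: "u \<in> V" "v \<in> V" "w \<in> V" and eq: "walk u v = walk u w"
  show "walk u (walk w v) = walk u v"
  proof (cases "u = v \<or> u = w")
    case True
    \<comment> \<open>here \<open>u = v = w\<close>, since \<open>walk u\<close> takes the value \<open>u\<close> at \<open>u\<close> only\<close>
    then have "v = u \<and> w = u" using walk_neq[of u v] walk_neq[of u w] V eq walk_self by metis
    then show ?thesis by simp
  next
    case False
    define x where "x = walk u v"
    have cells: "last_nbr u v x" "last_nbr u w x"
      using last_nbr_walk[of u v] last_nbr_walk[of u w] V False eq by (auto simp: x_def)
    have "last_nbr u (walk w v) x"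
      using last_nbr_convex[OF V walk_in cells walk_between] V by blast
    moreover from this have "u \<noteq> walk w v"
      using loop_trivial V adj_irrefl by (auto simp: last_nbr_def)
    ultimately show ?thesis using walk_eq_iff V walk_in x_def by blast
  qed
qed

end

section \<open>Every finite connected graph\<close>

theorem theorem3p6:
  fixes G :: "'a ugraph"
  assumes "finite_graph G" and "connected_graph G"
  shows "\<exists>V f. travel_groupoid V f \<and> smooth V f \<and> on_graph V f G"
proof -
  define adj where "adj a b \<longleftrightarrow> {a, b} \<in> edges G" for a b
  have simple: "e \<subseteq> verts G" "card e = 2" if "e \<in> edges G" for e
    using assms(1) that by (auto simp: finite_graph_def simple_graph_def)
  have fin: "finite (verts G)" and ne: "verts G \<noteq> {}"
    using assms by (auto simp: finite_graph_def connected_graph_def)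
  have sym: "adj b a" if "adj a b" for a b using that by (simp add: adj_def insert_commute)
  have irrefl: "\<not> adj a a" for a using simple(2)[of "{a, a}"] by (auto simp: adj_def)
  have inV: "b \<in> verts G" if "adj a b" for a b using simple(1) that by (auto simp: adj_def)
  have "(a, b) \<in> {(x, y). adj x y}\<^sup>*" if "a \<in> verts G" "b \<in> verts G" for a b
    using assms(2) that by (simp add: connected_graph_def adj_def)
  with fin ne sym inV obtain B where "tree_betweenness (verts G) adj B"
    using ex_tree_betweenness[of "verts G" adj] by blast
  then interpret finite_tree_betweenness "verts G" adj B
    using fin sym irrefl by (simp add: finite_tree_betweenness_def finite_tree_betweenness_axioms_def)
  have "edges G = {{u, v} | u v. u \<in> verts G \<and> v \<in> verts G \<and> u \<noteq> walk u v \<and> walk u v = v}"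
    (is "_ = ?E")
  proof
    show "edges G \<subseteq> ?E"
    proof
      fix e assume e: "e \<in> edges G"
      then obtain u v where uv: "e = {u, v}" "u \<noteq> v" using simple(2) by (meson card_2_iff)
      then have "u \<in> verts G" "v \<in> verts G" "adj u v" using e simple(1)[OF e] by (auto simp: adj_def)
      then have "e = {u, v} \<and> u \<in> verts G \<and> v \<in> verts G \<and> u \<noteq> walk u v \<and> walk u v = v"
        using walk_eq_target_iff[of u v] uv by simp
      then show "e \<in> ?E" by (intro CollectI exI)
    qed
    show "?E \<subseteq> edges G"
    proof
      fix e assume "e \<in> ?E"
      then obtain u v where "e = {u, v}" "u \<in> verts G" "v \<in> verts G" "u \<noteq> v" "walk u v = v"
        by force
      then show "e \<in> edges G" using walk_eq_target_iff by (simp add: adj_def)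
    qed
  qed
  then have "on_graph (verts G) walk G" by (simp add: on_graph_def)
  then show ?thesis using travel_groupoid_walk[OF ne] smooth_walk by blast
qed

end
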